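(* Let $X$ be a nonempty completely regular Hausdorff space. Say that a subring $A(X)$ of $F(X)$ has property (U) if for every $f\in A(X)$: $f$ is a unit of $A(X)$ if and only if $Z(f)=\emptyset$. The following are equivalent. (1) For every subring $A(X)$ of $F(X)$ that has property (U) and satisfies $C(X)\subseteq A(X)$, every proper ideal in $A(X)$ is pseudofixed. (2) There is a subring $A(X)$ of $F(X)$ that has property (U), contains $C(X)$ as a subring, and is such that every proper ideal in $A(X)$ is pseudofixed. (3) $X$ is compact. (4) Every proper ideal in $C(X)$ is fixed.
   Context: $F(X)$ is the ring of all functions $X\to\mathbb{R}$ with pointwise operations and $C(X)$ its subring of continuous functions. For $f\in F(X)$, $Z(f)=\{x\in X: f(x)=0\}$. An ideal $I$ of a subring of $F(X)$ is fixed if $\bigcap_{f\in I}Z(f)\neq\emptyset$. A proper ideal $I$ of a subring of $F(X)$ is pseudofixed if $\bigcap_{f\in I}\overline{Z(f)}\neq\emptyset$, where the bar denotes closure in $X$. *)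

theory Defs
  imports "HOL-Analysis.Analysis" "HOL-Algebra.Subrings"
begin

(* Real functions on S are represented by their extensional representatives, i.e. they take
   the value undefined outside S; equality in the ring is therefore equality on S. *)
definition fun_ring :: "'a set \<Rightarrow> ('a \<Rightarrow> real) ring" where
  "fun_ring S =
    \<lparr>carrier = S \<rightarrow>\<^sub>E UNIV,
     mult = (\<lambda>f g. \<lambda>x\<in>S. f x * g x),
     one = (\<lambda>x\<in>S. 1),
     zero = (\<lambda>x\<in>S. 0),
     add = (\<lambda>f g. \<lambda>x\<in>S. f x + g x)\<rparr>"

abbreviation F_ring :: "'a topology \<Rightarrow> ('a \<Rightarrow> real) ring" where
  "F_ring X \<equiv> fun_ring (topspace X)"

definition C_set :: "'a topology \<Rightarrow> ('a \<Rightarrow> real) set" where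
  "C_set X = {f \<in> carrier (F_ring X). continuous_map X euclideanreal f}"

(* The subring of F_ring X with underlying set A, as a ring in its own right; units and ideals
   below are those of this ring, not of F_ring X. *)
abbreviation F_subring :: "'a topology \<Rightarrow> ('a \<Rightarrow> real) set \<Rightarrow> ('a \<Rightarrow> real) ring" where
  "F_subring X A \<equiv> (F_ring X)\<lparr>carrier := A\<rparr>"

definition zero_set :: "'a topology \<Rightarrow> ('a \<Rightarrow> real) \<Rightarrow> 'a set" where
  "zero_set X f = {x \<in> topspace X. f x = 0}"

definition property_U :: "'a topology \<Rightarrow> ('a \<Rightarrow> real) set \<Rightarrow> bool" where
  "property_U X A \<longleftrightarrow> (\<forall>f\<in>A. f \<in> Units (F_subring X A) \<longleftrightarrow> zero_set X f = {})"

definition proper_ideal :: "('b, 'm) ring_scheme \<Rightarrow> 'b set \<Rightarrow> bool" where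
  "proper_ideal R I \<longleftrightarrow> ideal I R \<and> I \<noteq> carrier R"

(* In the next two definitions I is an ideal, hence nonempty, so the intersections are
   subsets of topspace X. *)
definition fixed_ideal :: "'a topology \<Rightarrow> ('a \<Rightarrow> real) set \<Rightarrow> bool" where
  "fixed_ideal X I \<longleftrightarrow> (\<Inter>f\<in>I. zero_set X f) \<noteq> {}"

definition pseudofixed_ideal :: "'a topology \<Rightarrow> ('a \<Rightarrow> real) set \<Rightarrow> bool" where
  "pseudofixed_ideal X I \<longleftrightarrow> (\<Inter>f\<in>I. X closure_of zero_set X f) \<noteq> {}"

lemma fun_ring_cring: "cring (fun_ring S)"
proof (rule cringI)
  show "abelian_group (fun_ring S)"
  proof (rule abelian_groupI)
    fix f assume "f \<in> carrier (fun_ring S)"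
    then show "\<exists>g\<in>carrier (fun_ring S). g \<oplus>\<^bsub>fun_ring S\<^esub> f = \<zero>\<^bsub>fun_ring S\<^esub>"
      by (intro bexI[of _ "\<lambda>x\<in>S. - f x"]) (auto simp: fun_ring_def)
  qed (auto simp: fun_ring_def PiE_iff extensional_def algebra_simps restrict_def fun_eq_iff)
  show "comm_monoid (fun_ring S)"
    by (rule comm_monoidI)
       (auto simp: fun_ring_def PiE_iff extensional_def restrict_def fun_eq_iff)
qed (auto simp: fun_ring_def restrict_def algebra_simps fun_eq_iff)

lemma C_set_subring: "subring (C_set X) (F_ring X)"
proof -
  interpret cring "F_ring X" by (rule fun_ring_cring)
  have neg: "\<ominus>\<^bsub>F_ring X\<^esub> f = (\<lambda>x\<in>topspace X. - f x)" if "f \<in> carrier (F_ring X)" for f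
    by (rule minus_equality) (use that in \<open>auto simp: fun_ring_def\<close>)
  have cont: "continuous_map X euclideanreal (restrict f (topspace X)) \<longleftrightarrow>
      continuous_map X euclideanreal f" for f
    by (auto elim!: continuous_map_eq)
  show ?thesis
  proof (rule subringI)
    fix f assume f: "f \<in> C_set X"
    then have "f \<in> carrier (F_ring X)" by (simp add: C_set_def)
    from neg[OF this] f show "\<ominus>\<^bsub>F_ring X\<^esub> f \<in> C_set X"
      by (auto simp: C_set_def cont fun_ring_def intro!: continuous_intros)
  qed (auto simp: C_set_def fun_ring_def cont intro!: continuous_intros)
qed

end

theory Submission
  imports Defs
begin

text \<open>The common zeros of finitely many members of an ideal are the zeros of the sum of their
  squares, which lies in the ideal. Under property (U) the zero sets of a proper ideal therefore have the finite
  intersection property, so on a compact space their closures meet. Conversely, if an open cover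
  has no finite subcover, then the functions of any ring between \<open>C(X)\<close> and \<open>F(X)\<close> that vanish
  outside some finite union of members of the cover form a proper ideal. By complete
  regularity every point is avoided by the (closed) zero set of some continuous function
  in this ideal, so it is not pseudofixed.\<close>

lemma fun_ring_a_inv:
  assumes "f \<in> carrier (fun_ring S)"
  shows "\<ominus>\<^bsub>fun_ring S\<^esub> f = (\<lambda>x\<in>S. - f x)"
proof -
  interpret cring "fun_ring S" by (rule fun_ring_cring)
  show ?thesis
    by (rule minus_equality) (use assms in \<open>auto simp: fun_ring_def\<close>)
qed

lemma ring_F_subring: "subring A (F_ring X) \<Longrightarrow> ring (F_subring X A)"
  by (rule ring.subring_is_ring[OF cring.axioms(1)[OF fun_ring_cring]])

lemma C_set_restrict:
  "continuous_map X euclideanreal f \<Longrightarrow> restrict f (topspace X) \<in> C_set X"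
  by (auto simp: C_set_def fun_ring_def elim: continuous_map_eq)

lemma closedin_zero_set: "f \<in> C_set X \<Longrightarrow> closedin X (zero_set X f)"
  using closedin_continuous_map_preimage[of X euclideanreal f "{0}"]
  by (simp add: C_set_def zero_set_def)

text \<open>The reciprocal of a nowhere vanishing continuous function is continuous. So C(X) is
  itself an admissible \<open>A\<close>: it is the instance of (1) and the witness for (2) used
  below.\<close>

lemma C_set_property_U: "property_U X (C_set X)"
  unfolding property_U_def
proof (intro ballI iffI)
  fix f assume "f \<in> Units (F_subring X (C_set X))"
  then obtain g where g: "(\<lambda>x\<in>topspace X. g x * f x) = (\<lambda>x\<in>topspace X. 1)"
    by (auto simp: Units_def fun_ring_def)
  have "g x * f x = 1" if "x \<in> topspace X" for x
    using fun_cong[OF g, of x] that by simp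
  then show "zero_set X f = {}" by (fastforce simp: zero_set_def)
next
  fix f assume f: "f \<in> C_set X" and Z: "zero_set X f = {}"
  then have nz: "f x \<noteq> 0" if "x \<in> topspace X" for x
    using that by (auto simp: zero_set_def)
  have "(\<lambda>x\<in>topspace X. inverse (f x)) \<in> C_set X"
    using f nz by (intro C_set_restrict continuous_map_real_inverse) (auto simp: C_set_def)
  then show "f \<in> Units (F_subring X (C_set X))"
    using f nz unfolding Units_def
    by (auto simp: fun_ring_def fun_eq_iff intro!: bexI[of _ "\<lambda>x\<in>topspace X. inverse (f x)"])
qed

lemma ideal_common_zeros:
  assumes "ideal I (F_subring X A)" "finite S" "S \<subseteq> I"
  shows "\<exists>g\<in>I. zero_set X g \<subseteq> (\<Inter>f\<in>S. zero_set X f)"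
  using assms(2,3)
proof (induction S)
  case empty
  then show ?case
    \<comment> \<open>The intersection over the empty family is \<open>UNIV\<close>, so any member
      of \<open>I\<close> serves; zero is one.\<close>
    using additive_subgroup.zero_closed[OF ideal.axioms(1)[OF assms(1)]] by auto
next
  case (insert f S)
  then obtain g where g: "g \<in> I" "zero_set X g \<subseteq> (\<Inter>f\<in>S. zero_set X f)" by auto
  interpret ideal I "F_subring X A" by (rule assms(1))
  let ?R = "F_subring X A"
  let ?h = "(f \<otimes>\<^bsub>?R\<^esub> f) \<oplus>\<^bsub>?R\<^esub> (g \<otimes>\<^bsub>?R\<^esub> g)"
  have "?h \<in> I"
    using insert.prems g(1) by
      (intro additive_subgroup.a_closed additive_subgroup_axioms I_l_closed Icarr) auto
  moreover have "zero_set X ?h = zero_set X f \<inter> zero_set X g"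
    by (auto simp: zero_set_def fun_ring_def)
  ultimately show ?case using g(2) by blast
qed

text \<open>By (U), a member without zeros would be a unit of \<open>A\<close>, and a proper ideal
  contains no unit.\<close>

lemma proper_ideal_zero_set_nonempty:
  assumes "property_U X A" "proper_ideal (F_subring X A) I" "f \<in> I"
  shows "zero_set X f \<noteq> {}"
proof
  assume Z: "zero_set X f = {}"
  interpret ideal I "F_subring X A" using assms(2) by (simp add: proper_ideal_def)
  have "f \<in> A" using assms(3) Icarr by auto
  with Z assms(1) have f: "f \<in> Units (F_subring X A)" by (auto simp: property_U_def)
  have "inv\<^bsub>F_subring X A\<^esub> f \<otimes>\<^bsub>F_subring X A\<^esub> f \<in> I"
    using f assms(3) by (intro I_l_closed Units_inv_closed)
  then have "I = carrier (F_subring X A)"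
    using f by (intro one_imp_carrier) (simp only: Units_l_inv)
  then show False using assms(2) by (simp add: proper_ideal_def)
qed

text \<open>Functions in \<open>A\<close> may be discontinuous and their zero sets not closed.
  Compactness is therefore applied to the closures, which yields pseudofixed rather than
  fixed.\<close>

lemma compact_imp_pseudofixed:
  assumes "compact_space X" "property_U X A" "proper_ideal (F_subring X A) I"
  shows "pseudofixed_ideal X I"
proof -
  have "(\<Inter>f\<in>S. X closure_of (zero_set X f)) \<noteq> {}" if S: "finite S" "S \<subseteq> I" for S
  proof -
    obtain g where g: "g \<in> I" "zero_set X g \<subseteq> (\<Inter>f\<in>S. zero_set X f)"
      using ideal_common_zeros S assms(3) unfolding proper_ideal_def by blast
    then obtain x where "x \<in> zero_set X g"
      using proper_ideal_zero_set_nonempty assms(2,3) by blast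
    with g(2) have "x \<in> X closure_of (zero_set X f)" if "f \<in> S" for f
      using that closure_of_subset[of "zero_set X f" X] by (auto simp: zero_set_def)
    then show ?thesis by blast
  qed
  \<comment> \<open>A finite family of such closures is the image of a finite subset of
    \<open>I\<close>.\<close>
  then have "\<Inter>\<F> \<noteq> {}"
    if "finite \<F>" "\<F> \<subseteq> (\<lambda>f. X closure_of (zero_set X f)) ` I" for \<F>
    using that by (metis finite_subset_image)
  then have "\<Inter>((\<lambda>f. X closure_of (zero_set X f)) ` I) \<noteq> {}"
    using assms(1)[unfolded compact_space_fip] by (metis (no_types, lifting) closedin_closure_of imageE)
  then show ?thesis by (simp add: pseudofixed_ideal_def)
qed

text \<open>One ring suffices to force compactness, so this serves (1) and (4) with \<open>A\<close>
  equal to C(X), and (2) with whatever ring is given.\<close>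

lemma compact_if_pseudofixed:
  assumes "completely_regular_space X" and A: "subring A (F_ring X)" "C_set X \<subseteq> A"
    and pf: "\<And>I. proper_ideal (F_subring X A) I \<Longrightarrow> pseudofixed_ideal X I"
  shows "compact_space X"
proof (rule ccontr)
  assume "\<not> compact_space X"
  then obtain \<U> where U: "\<forall>U\<in>\<U>. openin X U" "topspace X \<subseteq> \<Union>\<U>"
    and no_sub: "\<And>\<F>. finite \<F> \<Longrightarrow> \<F> \<subseteq> \<U> \<Longrightarrow> \<not> topspace X \<subseteq> \<Union>\<F>"
    unfolding compact_space_alt by metis
  define I where "I = {f \<in> A. \<exists>\<F>. finite \<F> \<and> \<F> \<subseteq> \<U> \<and> topspace X - \<Union>\<F> \<subseteq> zero_set X f}"
  \<comment> \<open>Multiplication can only enlarge a zero set, so this monotonicity gives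
    absorption of products.\<close>
  have I_mono: "g \<in> I" if "f \<in> I" "g \<in> A" "zero_set X f \<subseteq> zero_set X g" for f g
  proof -
    obtain \<F> where \<F>: "finite \<F>" "\<F> \<subseteq> \<U>" "topspace X - \<Union>\<F> \<subseteq> zero_set X f"
      using \<open>f \<in> I\<close> by (auto simp: I_def)
    have "topspace X - \<Union>\<F> \<subseteq> zero_set X g"
      using \<F>(3) that(3) by (rule subset_trans)
    with \<F> \<open>g \<in> A\<close> show ?thesis by (auto simp: I_def)
  qed
  interpret R: ring "F_subring X A" using A(1) by (rule ring_F_subring)
  have sub: "A \<subseteq> carrier (F_ring X)" using subringE(1)[OF A(1)] .
  have "ideal I (F_subring X A)"
  proof (rule idealI)
    show "ring (F_subring X A)" by (rule R.ring_axioms)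
    show "subgroup I (add_monoid (F_subring X A))"
    proof (rule R.add.subgroupI)
      show "I \<subseteq> carrier (F_subring X A)" by (auto simp: I_def)
      have "\<zero>\<^bsub>F_ring X\<^esub> \<in> I"
        using subringE(2)[OF A(1)]
        by (auto simp: I_def zero_set_def fun_ring_def intro!: exI[of _ "{}"])
      then show "I \<noteq> {}" by blast
    next
      fix f assume f: "f \<in> I"
      then have "f \<in> A" by (simp add: I_def)
      then have neg: "(\<lambda>x\<in>topspace X. - f x) \<in> A"
        using subringE(5)[OF A(1)] fun_ring_a_inv sub by (metis subsetD)
      \<comment> \<open>The additive inverse is defined relative to the carrier, so it is computed
        afresh in the subring, by uniqueness.\<close>
      have "\<ominus>\<^bsub>F_subring X A\<^esub> f = (\<lambda>x\<in>topspace X. - f x)"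
        by (rule R.minus_equality) (use neg \<open>f \<in> A\<close> in \<open>auto simp: fun_ring_def\<close>)
      moreover have "zero_set X (\<lambda>x\<in>topspace X. - f x) = zero_set X f"
        by (auto simp: zero_set_def)
      ultimately show "\<ominus>\<^bsub>F_subring X A\<^esub> f \<in> I" using f neg by (simp add: I_def)
    next
      fix f g assume fg: "f \<in> I" "g \<in> I"
      then obtain \<F> \<G> where "finite \<F>" "\<F> \<subseteq> \<U>" "topspace X - \<Union>\<F> \<subseteq> zero_set X f"
        "finite \<G>" "\<G> \<subseteq> \<U>" "topspace X - \<Union>\<G> \<subseteq> zero_set X g" by (auto simp: I_def)
      moreover have "zero_set X f \<inter> zero_set X g \<subseteq> zero_set X (f \<oplus>\<^bsub>F_subring X A\<^esub> g)"
        by (auto simp: zero_set_def fun_ring_def)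
      \<comment> \<open>Outside the union of both finite subfamilies the two functions vanish
        together, hence so does their sum.\<close>
      ultimately have "finite (\<F> \<union> \<G>)" "\<F> \<union> \<G> \<subseteq> \<U>"
        "topspace X - \<Union>(\<F> \<union> \<G>) \<subseteq> zero_set X (f \<oplus>\<^bsub>F_subring X A\<^esub> g)"
        by blast+
      moreover have "f \<oplus>\<^bsub>F_subring X A\<^esub> g \<in> A"
        using fg subringE(7)[OF A(1)] by (simp add: I_def)
      ultimately show "f \<oplus>\<^bsub>F_subring X A\<^esub> g \<in> I" unfolding I_def by blast
    qed
  next
    fix f g assume fg: "f \<in> I" "g \<in> carrier (F_subring X A)"
    have "zero_set X f \<subseteq> zero_set X (g \<otimes>\<^bsub>F_subring X A\<^esub> f)"
      "zero_set X f \<subseteq> zero_set X (f \<otimes>\<^bsub>F_subring X A\<^esub> g)"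
      by (auto simp: zero_set_def fun_ring_def)
    moreover have "g \<otimes>\<^bsub>F_subring X A\<^esub> f \<in> A" "f \<otimes>\<^bsub>F_subring X A\<^esub> g \<in> A"
      using fg subringE(6)[OF A(1)] by (auto simp: I_def)
    ultimately show "g \<otimes>\<^bsub>F_subring X A\<^esub> f \<in> I" "f \<otimes>\<^bsub>F_subring X A\<^esub> g \<in> I"
      using I_mono[OF fg(1)] by auto
  qed
  \<comment> \<open>The constant one has no zeros, so its membership would provide a finite
    subcover.\<close>
  moreover have "\<one>\<^bsub>F_ring X\<^esub> \<notin> I"
    using no_sub by (auto simp: I_def zero_set_def fun_ring_def)
  ultimately have "proper_ideal (F_subring X A) I"
    using subringE(3)[OF A(1)] by (auto simp: proper_ideal_def)
  with pf have "pseudofixed_ideal X I" by blast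
  then obtain x where x: "\<And>f. f \<in> I \<Longrightarrow> x \<in> X closure_of (zero_set X f)"
    by (auto simp: pseudofixed_ideal_def)
  \<comment> \<open>Some member of \<open>I\<close> is needed to place \<open>x\<close> in the
    space, since closures lie in \<open>topspace X\<close>.\<close>
  have "\<zero>\<^bsub>F_subring X A\<^esub> \<in> I"
    using \<open>ideal I (F_subring X A)\<close> by (intro additive_subgroup.zero_closed ideal.axioms(1))
  then have "x \<in> topspace X" using x in_closure_of by fast
  with U obtain V where V: "V \<in> \<U>" "x \<in> V" "openin X V" by blast
  \<comment> \<open>Complete regularity separates \<open>x\<close> from the closed complement of
    \<open>V\<close>; the one-element subfamily \<open>{V}\<close> then puts the restriction of
    \<open>h\<close> into \<open>I\<close>.\<close>
  then obtain h
    where h: "continuous_map X euclideanreal h" "h x = 1" "h ` (topspace X - V) \<subseteq> {0}"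
    using assms(1) completely_regular_space_gen_alt'[of "1::real" 0 X]
    by (metis zero_neq_one)
  define f where "f = restrict h (topspace X)"
  have f: "f \<in> C_set X"
    unfolding f_def using h(1) by (rule C_set_restrict)
  moreover have "topspace X - \<Union>{V} \<subseteq> zero_set X f"
    using h(3) by (auto simp: zero_set_def f_def)
  ultimately have "f \<in> I"
    using A(2) V(1) unfolding I_def by (intro CollectI conjI exI[of _ "{V}"]) auto
  \<comment> \<open>The zero set of the continuous \<open>f\<close> equals its closure, so
    \<open>f\<close> vanishes at \<open>x\<close>, although \<open>h x = 1\<close>.\<close>
  then have "x \<in> zero_set X f"
    using x closure_of_closedin[OF closedin_zero_set[OF f]] by blast
  then show False using h(2) by (auto simp: zero_set_def f_def)
qed

text \<open>Zero sets of continuous functions are already closed. This reduces (4) to the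
  pseudofixed case for C(X).\<close>

lemma fixed_ideal_C_set_iff:
  assumes "I \<subseteq> C_set X"
  shows "fixed_ideal X I \<longleftrightarrow> pseudofixed_ideal X I"
proof -
  have "X closure_of (zero_set X f) = zero_set X f" if "f \<in> I" for f
    using that assms closedin_zero_set closure_of_closedin by blast
  then show ?thesis by (simp add: fixed_ideal_def pseudofixed_ideal_def)
qed

theorem proposition3p11:
  fixes X :: "'a topology"
  assumes "topspace X \<noteq> {}"
    and "completely_regular_space X"
    and "Hausdorff_space X"
  shows "((\<forall>A. subring A (F_ring X) \<and> property_U X A \<and> C_set X \<subseteq> A \<longrightarrow>
              (\<forall>I. proper_ideal (F_subring X A) I \<longrightarrow> pseudofixed_ideal X I))
            \<longleftrightarrow> compact_space X)
       \<and> ((\<exists>A. subring A (F_ring X) \<and> property_U X A \<and> subring (C_set X) (F_subring X A) \<and>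
              (\<forall>I. proper_ideal (F_subring X A) I \<longrightarrow> pseudofixed_ideal X I))
            \<longleftrightarrow> compact_space X)
       \<and> ((\<forall>I. proper_ideal (F_subring X (C_set X)) I \<longrightarrow> fixed_ideal X I)
            \<longleftrightarrow> compact_space X)"
proof (intro conjI iffI allI impI)
  assume "\<forall>A. subring A (F_ring X) \<and> property_U X A \<and> C_set X \<subseteq> A \<longrightarrow>
      (\<forall>I. proper_ideal (F_subring X A) I \<longrightarrow> pseudofixed_ideal X I)"
  then show "compact_space X"
    using compact_if_pseudofixed[OF assms(2) C_set_subring] C_set_subring C_set_property_U by blast
next
  fix A I
  assume "compact_space X" "subring A (F_ring X) \<and> property_U X A \<and> C_set X \<subseteq> A"
    "proper_ideal (F_subring X A) I"
  then show "pseudofixed_ideal X I" using compact_imp_pseudofixed by blast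
next
  assume "\<exists>A. subring A (F_ring X) \<and> property_U X A \<and> subring (C_set X) (F_subring X A) \<and>
      (\<forall>I. proper_ideal (F_subring X A) I \<longrightarrow> pseudofixed_ideal X I)"
  then obtain A where A: "subring A (F_ring X)" "subring (C_set X) (F_subring X A)"
    "\<And>I. proper_ideal (F_subring X A) I \<Longrightarrow> pseudofixed_ideal X I" by blast
  from subringE(1)[OF A(2)] have "C_set X \<subseteq> A" by simp
  with A show "compact_space X" using compact_if_pseudofixed assms(2) by blast
next
  assume "compact_space X"
  moreover have "subring (C_set X) (F_subring X (C_set X))"
    using ring.carrier_is_subring[OF ring_F_subring[OF C_set_subring]] by simp
  ultimately show "\<exists>A. subring A (F_ring X) \<and> property_U X A \<and>
      subring (C_set X) (F_subring X A) \<and>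
      (\<forall>I. proper_ideal (F_subring X A) I \<longrightarrow> pseudofixed_ideal X I)"
    using C_set_subring C_set_property_U compact_imp_pseudofixed by blast
next
  have sub: "I \<subseteq> C_set X" if "proper_ideal (F_subring X (C_set X)) I" for I
    using that ideal.Icarr[of I "F_subring X (C_set X)"] by (auto simp: proper_ideal_def)
  {
    assume "\<forall>I. proper_ideal (F_subring X (C_set X)) I \<longrightarrow> fixed_ideal X I"
    then show "compact_space X"
      using compact_if_pseudofixed[OF assms(2) C_set_subring] fixed_ideal_C_set_iff sub by blast
  next
    fix I assume "compact_space X" "proper_ideal (F_subring X (C_set X)) I"
    then show "fixed_ideal X I"
      using compact_imp_pseudofixed C_set_property_U fixed_ideal_C_set_iff sub by blast
  }
qed

end
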